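(* Let $(\Omega,\mathcal F)$ be a measurable space with a $\sigma$-finite reference measure $\tau$, let $M:\Omega\to\mathcal Y$ be a measurable map, let $E,N:\Omega\to\mathbb R$ be measurable, and let $\ell_V(x)=\log\tau\bigl(M^{-1}(M(x))\bigr)$. Let $D\subseteq\mathbb R^3$ be an open set of constraint values $(U,\bar N,\bar\ell_V)$. Assume that for each $(U,\bar N,\bar\ell_V)\in D$ the problem of minimizing $D_{\mathrm{KL}}(p\,\|\,\tau)$ over probability measures $p\ll\tau$ on $\Omega$ subject to $$\mathbb E_p[E]=U,\qquad \mathbb E_p[N]=\bar N,\qquad \mathbb E_p[\ell_V]=\bar\ell_V$$ has a unique solution $p^\ast=p^\ast(U,\bar N,\bar\ell_V)$, of the exponential form $$p^\ast(\mathrm dx)=\frac{1}{Z(\beta,\alpha,\pi)}\exp\bigl(-\beta E(x)-\alpha N(x)-\pi\ell_V(x)\bigr)\,\tau(\mathrm dx)$$ with multipliers $(\beta,\alpha,\pi)$ depending on $(U,\bar N,\bar\ell_V)$ and lying in an open set on which the log-partition function $$\Psi(\beta,\alpha,\pi)=\log\int_\Omega \exp\bigl(-\beta E-\alpha N-\pi\ell_V\bigr)\,\mathrm d\tau=\log Z(\beta,\alpha,\pi)$$ is finite, and that $\Psi$ is $C^2$ and convex there. Define $S^\ast(U,\bar N,\bar\ell_V):=-D_{\mathrm{KL}}(p^\ast\,\|\,\tau)$. Then the total differential of $S^\ast$ on $D$ is $$\mathrm dS^\ast=\beta\,\mathrm dU+\alpha\,\mathrm d\bar N+\pi\,\mathrm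 d\bar\ell_V .$$ Moreover, with $T,\mu,P$ defined (where $\beta\neq0$) by $\frac1T:=\beta$, $-\frac{\mu}{T}:=\alpha$, $\frac PT:=\pi$, one has $$\mathrm dU=T\,\mathrm dS^\ast-P\,\mathrm d\bar\ell_V+\mu\,\mathrm d\bar N .$$
   Context: For a probability measure $p\ll\tau$ with Radon–Nikodym density $r=\mathrm dp/\mathrm d\tau$, $D_{\mathrm{KL}}(p\,\|\,\tau):=\int_\Omega \log r\,\mathrm dp=\int_\Omega r\log r\,\mathrm d\tau$ (here $\tau$ need not be a probability measure). The sets $C_y:=M^{-1}(y)$ are called cells, $v(y):=\tau(C_y)$ is the information volume of the cell, and $\ell_V(x)=\log v(M(x))$ is the log-volume variable, taken to be a real-valued measurable function on $\Omega$. $E$ is the energy and $N$ the particle number; $\mathbb E_p$ denotes expectation under $p$. $T$ is called temperature, $\mu$ chemical potential, $P$ pressure. *)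

theory Defs
  imports "HOL-Probability.Probability"
begin

definition cell :: "'a measure \<Rightarrow> ('a \<Rightarrow> 'b) \<Rightarrow> 'b \<Rightarrow> 'a set" where
  "cell \<tau> M y = M -` {y} \<inter> space \<tau>"

definition info_volume :: "'a measure \<Rightarrow> ('a \<Rightarrow> 'b) \<Rightarrow> 'b \<Rightarrow> ennreal" where
  "info_volume \<tau> M y = emeasure \<tau> (cell \<tau> M y)"

definition log_volume :: "'a measure \<Rightarrow> ('a \<Rightarrow> 'b) \<Rightarrow> 'a \<Rightarrow> real" where
  "log_volume \<tau> M x = ln (enn2real (info_volume \<tau> M (M x)))"

text \<open>
  For \<^term>\<open>p\<close> absolutely continuous with respect to \<^term>\<open>\<tau>\<close>, the function
  \<^term>\<open>entropy_density (exp 1) \<tau> p\<close> is the natural logarithm of the Radon-Nikodym density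
  of \<^term>\<open>p\<close>. The library's \<^const>\<open>KL_divergence\<close> is a Bochner integral and hence \<open>0\<close> whenever
  this function is not \<^term>\<open>p\<close>-integrable, which would make such measures spurious competitors in a
  minimization. The divergence is therefore taken in the extended reals, as the integral of the
  positive part minus that of the negative part (where \<open>\<infinity> - \<infinity> = \<infinity>\<close>).
\<close>

definition KL_ereal :: "'a measure \<Rightarrow> 'a measure \<Rightarrow> ereal" where
  "KL_ereal \<tau> p =
     enn2ereal (\<integral>\<^sup>+x. ennreal (entropy_density (exp 1) \<tau> p x) \<partial>p)
     - enn2ereal (\<integral>\<^sup>+x. ennreal (- entropy_density (exp 1) \<tau> p x) \<partial>p)"

lemma KL_ereal_eq_KL_divergence:
  assumes "integrable p (entropy_density (exp 1) \<tau> p)"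
  shows "KL_ereal \<tau> p = ereal (KL_divergence (exp 1) \<tau> p)"
proof -
  let ?f = "entropy_density (exp 1) \<tau> p"
  have "(\<integral>\<^sup>+x. ennreal (?f x) \<partial>p) < \<top>" "(\<integral>\<^sup>+x. ennreal (- ?f x) \<partial>p) < \<top>"
    using assms by (auto simp: real_integrable_def top.not_eq_extremum)
  then show ?thesis
    unfolding KL_ereal_def KL_divergence_def real_lebesgue_integral_def[OF assms]
    by (cases "\<integral>\<^sup>+x. ennreal (?f x) \<partial>p"; cases "\<integral>\<^sup>+x. ennreal (- ?f x) \<partial>p")
      (auto simp: enn2ereal_ennreal)
qed

definition feasible ::
  "'a measure \<Rightarrow> ('a \<Rightarrow> real) \<Rightarrow> ('a \<Rightarrow> real) \<Rightarrow> ('a \<Rightarrow> real) \<Rightarrow> real \<times> real \<times> real \<Rightarrow> 'a measure \<Rightarrow> bool"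
where
  "feasible \<tau> E N L = (\<lambda>(U, Nbar, Lbar) p.
     prob_space p \<and> sets p = sets \<tau> \<and> absolutely_continuous \<tau> p \<and>
     integrable p E \<and> (\<integral>x. E x \<partial>p) = U \<and>
     integrable p N \<and> (\<integral>x. N x \<partial>p) = Nbar \<and>
     integrable p L \<and> (\<integral>x. L x \<partial>p) = Lbar)"

definition gibbs_weight ::
  "('a \<Rightarrow> real) \<Rightarrow> ('a \<Rightarrow> real) \<Rightarrow> ('a \<Rightarrow> real) \<Rightarrow> real \<times> real \<times> real \<Rightarrow> 'a \<Rightarrow> real"
where
  "gibbs_weight E N L = (\<lambda>(\<beta>, \<alpha>, \<pi>) x. exp (- \<beta> * E x - \<alpha> * N x - \<pi> * L x))"

definition partition_function ::
  "'a measure \<Rightarrow> ('a \<Rightarrow> real) \<Rightarrow> ('a \<Rightarrow> real) \<Rightarrow> ('a \<Rightarrow> real) \<Rightarrow> real \<times> real \<times> real \<Rightarrow> ennreal"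
where
  "partition_function \<tau> E N L \<theta> = (\<integral>\<^sup>+x. ennreal (gibbs_weight E N L \<theta> x) \<partial>\<tau>)"

definition log_partition ::
  "'a measure \<Rightarrow> ('a \<Rightarrow> real) \<Rightarrow> ('a \<Rightarrow> real) \<Rightarrow> ('a \<Rightarrow> real) \<Rightarrow> real \<times> real \<times> real \<Rightarrow> real"
where
  "log_partition \<tau> E N L \<theta> = ln (enn2real (partition_function \<tau> E N L \<theta>))"

definition gibbs_measure ::
  "'a measure \<Rightarrow> ('a \<Rightarrow> real) \<Rightarrow> ('a \<Rightarrow> real) \<Rightarrow> ('a \<Rightarrow> real) \<Rightarrow> real \<times> real \<times> real \<Rightarrow> 'a measure"
where
  "gibbs_measure \<tau> E N L \<theta> =
     density \<tau> (\<lambda>x. ennreal (gibbs_weight E N L \<theta> x / enn2real (partition_function \<tau> E N L \<theta>)))"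

definition C2_on :: "'a::real_normed_vector set \<Rightarrow> ('a \<Rightarrow> real) \<Rightarrow> bool" where
  "C2_on G f \<longleftrightarrow>
     (\<exists>(f' :: 'a \<Rightarrow> 'a \<Rightarrow>\<^sub>L real) (f'' :: 'a \<Rightarrow> 'a \<Rightarrow>\<^sub>L ('a \<Rightarrow>\<^sub>L real)).
        (\<forall>x\<in>G. (f has_derivative blinfun_apply (f' x)) (at x)) \<and>
        (\<forall>x\<in>G. (f' has_derivative blinfun_apply (f'' x)) (at x)) \<and>
        continuous_on G f'')"

text \<open>
  The library's \<^const>\<open>convex_on\<close> demands a convex domain. On a merely open set, convexity of a
  function is understood as convexity on each convex subset.
\<close>

definition convex_within :: "'a::real_vector set \<Rightarrow> ('a \<Rightarrow> real) \<Rightarrow> bool" where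
  "convex_within G f \<longleftrightarrow> (\<forall>C. C \<subseteq> G \<and> convex C \<longrightarrow> convex_on C f)"

definition max_entropy :: "'a measure \<Rightarrow> ('b \<Rightarrow> 'a measure) \<Rightarrow> 'b \<Rightarrow> real" where
  "max_entropy \<tau> p u = - real_of_ereal (KL_ereal \<tau> (p u))"

end

theory Submission
  imports Defs
begin

text \<open>
  Put \<open>X = (E, N, \<ell>\<^sub>V)\<close>, so that the Gibbs measure at \<open>\<theta>\<close> has density proportional to
  \<open>exp (- \<theta> \<bullet> X)\<close>. The optimal measure at \<open>u\<close> has multiplier \<open>\<theta> u\<close> and mean \<open>u\<close>, hence entropy
  \<open>\<Psi> (\<theta> u) + \<theta> u \<bullet> u\<close>, and \<open>\<theta> u\<close> minimizes \<open>\<eta> \<mapsto> \<Psi> \<eta> + \<eta> \<bullet> u\<close>: the maximal entropy is a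
  Legendre transform of \<open>\<Psi>\<close>. The minimizer is unique since otherwise \<open>X\<close> would be a.e. in a
  hyperplane, contradicting that the attained means fill an open set. By convexity the unique
  minimizer depends continuously on \<open>u\<close>, and the two-sided estimate
  \<open>\<theta> w \<bullet> (w - u) \<le> S w - S u \<le> \<theta> u \<bullet> (w - u)\<close> then identifies the derivative of \<open>S\<close> as \<open>\<theta> u\<close>.
\<close>

section \<open>Derivative of the optimal value of a linearly perturbed minimization problem\<close>

text \<open>If \<open>\<theta> w\<close> stayed away from \<open>\<theta> u\<close> while
  \<open>w\<close> tends to \<open>u\<close>, the segment joining them would cross a small sphere
  around \<open>\<theta> u\<close>, on which the objective at \<open>u\<close> exceeds its minimum
  by a fixed gap; \<open>quasiconvex\<close> at the crossing point rules this out. As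
  \<open>G\<close> may fail to be convex, \<open>quasiconvex\<close> speaks only of those segment
  points that lie in \<open>G\<close>.\<close>

lemma has_derivative_of_unique_minimizer:
  fixes F :: "'e::euclidean_space \<Rightarrow> real" and \<theta> :: "'e \<Rightarrow> 'e"
  assumes D: "open D" "u \<in> D" and G: "open G" and \<theta>_in: "\<And>w. w \<in> D \<Longrightarrow> \<theta> w \<in> G"
    and cont: "continuous_on G F"
    and min: "\<And>w \<eta>. w \<in> D \<Longrightarrow> \<eta> \<in> G \<Longrightarrow> F (\<theta> w) + \<theta> w \<bullet> w \<le> F \<eta> + \<eta> \<bullet> w"
    and uniq: "\<And>\<eta>. \<eta> \<in> G \<Longrightarrow> F \<eta> + \<eta> \<bullet> u = F (\<theta> u) + \<theta> u \<bullet> u \<Longrightarrow> \<eta> = \<theta> u"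
    and quasiconvex: "\<And>w t. w \<in> D \<Longrightarrow> 0 \<le> t \<Longrightarrow> t \<le> 1 \<Longrightarrow>
        (1 - t) *\<^sub>R \<theta> u + t *\<^sub>R \<theta> w \<in> G \<Longrightarrow>
        F ((1 - t) *\<^sub>R \<theta> u + t *\<^sub>R \<theta> w) + ((1 - t) *\<^sub>R \<theta> u + t *\<^sub>R \<theta> w) \<bullet> w
          \<le> F (\<theta> u) + \<theta> u \<bullet> w"
  shows "((\<lambda>w. F (\<theta> w) + \<theta> w \<bullet> w) has_derivative (\<lambda>h. \<theta> u \<bullet> h)) (at u)"
proof -
  have near: "\<exists>d>0. \<forall>w. dist w u < d \<longrightarrow> w \<in> D \<and> dist (\<theta> w) (\<theta> u) < e" if e: "e > 0" for e
  proof -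
    obtain e0 where e0: "e0 > 0" "cball (\<theta> u) e0 \<subseteq> G"
      using G \<theta>_in[OF D(2)] open_contains_cball by blast
    \<comment> \<open>The closed ball of radius \<open>r\<close> lies in \<open>G\<close>, and
      \<open>r < e\<close> puts every point at distance at least \<open>e\<close> beyond the
      sphere.\<close>
    define r where "r = min e0 (e / 2)"
    have r: "r > 0" "r < e" "cball (\<theta> u) r \<subseteq> G"
      using e0 e by (auto simp: r_def)
    have S: "compact (sphere (\<theta> u) r)" "sphere (\<theta> u) r \<noteq> {}" "sphere (\<theta> u) r \<subseteq> G"
      using r by auto
    have "continuous_on (sphere (\<theta> u) r) (\<lambda>\<eta>. F \<eta> + \<eta> \<bullet> u)"
      by (intro continuous_intros continuous_on_subset[OF cont] S)
    then obtain s where s: "s \<in> sphere (\<theta> u) r"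
      and s_min: "\<And>\<eta>. \<eta> \<in> sphere (\<theta> u) r \<Longrightarrow> F s + s \<bullet> u \<le> F \<eta> + \<eta> \<bullet> u"
      using continuous_attains_inf[OF S(1,2)] by blast
    define gap where "gap = F s + s \<bullet> u - (F (\<theta> u) + \<theta> u \<bullet> u)"
    have "s \<in> G" "s \<noteq> \<theta> u" using s S r by auto
    then have "F (\<theta> u) + \<theta> u \<bullet> u \<noteq> F s + s \<bullet> u"
      using uniq[of s] by metis
    with min[OF D(2) \<open>s \<in> G\<close>] have gap: "gap > 0"
      unfolding gap_def by linarith
    obtain d0 where d0: "d0 > 0" "ball u d0 \<subseteq> D"
      using D open_contains_ball by blast
    \<comment> \<open>Replacing \<open>u\<close> by \<open>w\<close> in the objective changes its
      increment from \<open>\<theta> u\<close> to a point of the sphere by at most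
      \<open>r * norm (u - w)\<close>, which this bound keeps below \<open>gap\<close>.\<close>
    define d where "d = min d0 (gap / r)"
    have "d > 0" using d0 gap r by (simp add: d_def)
    moreover have "w \<in> D \<and> dist (\<theta> w) (\<theta> u) < e" if w: "dist w u < d" for w
    proof
      show wD: "w \<in> D" using w d0 by (auto simp: d_def dist_commute)
      show "dist (\<theta> w) (\<theta> u) < e"
      proof (rule ccontr)
        assume "\<not> dist (\<theta> w) (\<theta> u) < e"
        then have big: "norm (\<theta> w - \<theta> u) \<ge> e" by (simp add: dist_norm)
        \<comment> \<open>Parameter at which the segment from \<open>\<theta> u\<close> to
          \<open>\<theta> w\<close> meets the sphere.\<close>
        define t where "t = r / norm (\<theta> w - \<theta> u)"
        define \<eta> where "\<eta> = (1 - t) *\<^sub>R \<theta> u + t *\<^sub>R \<theta> w"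
        have t: "0 \<le> t" "t \<le> 1" using big r e by (auto simp: t_def divide_simps)
        have \<eta>_diff: "\<eta> - \<theta> u = t *\<^sub>R (\<theta> w - \<theta> u)"
          by (simp add: \<eta>_def algebra_simps)
        have norm_\<eta>: "norm (\<eta> - \<theta> u) = r"
          using big r e by (auto simp: \<eta>_diff t_def)
        then have sph: "\<eta> \<in> sphere (\<theta> u) r" by (simp add: dist_norm norm_minus_commute)
        then have "F \<eta> + \<eta> \<bullet> w \<le> F (\<theta> u) + \<theta> u \<bullet> w"
          using quasiconvex[OF wD t] S unfolding \<eta>_def by blast
        moreover have "gap + (F (\<theta> u) + \<theta> u \<bullet> u) \<le> F \<eta> + \<eta> \<bullet> u"
          using s_min[OF sph] by (simp add: gap_def)
        ultimately have "gap \<le> (\<eta> - \<theta> u) \<bullet> (u - w)"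
          by (simp add: inner_diff_left inner_diff_right)
        also have "\<dots> \<le> r * norm (u - w)"
          using norm_cauchy_schwarz[of "\<eta> - \<theta> u" "u - w"] norm_\<eta> by simp
        also have "\<dots> < r * (gap / r)"
          using w r by (intro mult_strict_left_mono) (auto simp: d_def dist_norm norm_minus_commute)
        finally show False using r by simp
      qed
    qed
    ultimately show ?thesis by blast
  qed
  show ?thesis
    unfolding has_derivative_at_alt
  proof (intro conjI allI impI)
    show "bounded_linear ((\<bullet>) (\<theta> u))" by (rule bounded_linear_inner_right)
    fix e :: real assume "0 < e"
    then obtain d where d: "d > 0"
      "\<And>w. dist w u < d \<Longrightarrow> w \<in> D" "\<And>w. dist w u < d \<Longrightarrow> dist (\<theta> w) (\<theta> u) < e"
      using near by blast
    have "norm (F (\<theta> w) + \<theta> w \<bullet> w - (F (\<theta> u) + \<theta> u \<bullet> u) - \<theta> u \<bullet> (w - u)) \<le> e * norm (w - u)"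
      if "norm (w - u) < d" for w
    proof -
      have wD: "w \<in> D" and close: "norm (\<theta> w - \<theta> u) \<le> e"
        using d(2,3)[of w] that by (auto simp: dist_norm)
      let ?R = "F (\<theta> w) + \<theta> w \<bullet> w - (F (\<theta> u) + \<theta> u \<bullet> u) - \<theta> u \<bullet> (w - u)"
      \<comment> \<open>Testing minimality at \<open>w\<close> with the competitor
        \<open>\<theta> u\<close> bounds the remainder above by 0. Testing it at \<open>u\<close>
        with the competitor \<open>\<theta> w\<close> bounds it below by
        \<open>(\<theta> w - \<theta> u) \<bullet> (w - u)\<close>, which is small by continuity of
        \<open>\<theta>\<close> at \<open>u\<close>.\<close>
      have "?R \<le> 0"
        using min[OF wD \<theta>_in[OF D(2)]] by (simp add: inner_diff_right)
      moreover have "F (\<theta> u) + \<theta> u \<bullet> u \<le> F (\<theta> w) + \<theta> w \<bullet> u"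
        using min[OF D(2) \<theta>_in[OF wD]] .
      moreover have "(\<theta> w - \<theta> u) \<bullet> (w - u) \<ge> - (e * norm (w - u))"
        using norm_cauchy_schwarz[of "\<theta> u - \<theta> w" "w - u"] mult_right_mono[OF close, of "norm (w - u)"]
        by (simp add: inner_diff_left norm_minus_commute)
      ultimately show ?thesis
        by (simp add: inner_diff_left inner_diff_right)
    qed
    with d(1) show "\<exists>d>0. \<forall>w. norm (w - u) < d \<longrightarrow>
        norm (F (\<theta> w) + \<theta> w \<bullet> w - (F (\<theta> u) + \<theta> u \<bullet> u) - \<theta> u \<bullet> (w - u)) \<le> e * norm (w - u)"
      by blast
  qed
qed

section \<open>Entropy and free entropy of an exponential family\<close>

locale exponential_family = sigma_finite_measure \<tau>
  for \<tau> :: "'a measure" and X :: "'a \<Rightarrow> 'e::euclidean_space" +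
  assumes measurable_X [measurable]: "X \<in> borel_measurable \<tau>"
begin

definition weight :: "'e \<Rightarrow> 'a \<Rightarrow> real" where
  "weight \<theta> x = exp (- (\<theta> \<bullet> X x))"

definition norm_const :: "'e \<Rightarrow> real" where
  "norm_const \<theta> = (LINT x|\<tau>. weight \<theta> x)"

definition gibbs :: "'e \<Rightarrow> 'a measure" where
  "gibbs \<theta> = density \<tau> (\<lambda>x. ennreal (weight \<theta> x / norm_const \<theta>))"

text \<open>The mean is tested against linear functionals because it is used for the directions
  \<open>\<theta>\<close> and \<open>\<eta> - \<theta>\<close>.\<close>

definition has_mean :: "'a measure \<Rightarrow> 'e \<Rightarrow> bool" where
  "has_mean p u \<longleftrightarrow> prob_space p \<and>
     (\<forall>v. integrable p (\<lambda>x. v \<bullet> X x) \<and> (LINT x|p. v \<bullet> X x) = v \<bullet> u)"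

lemma measurable_weight [measurable]: "weight \<theta> \<in> borel_measurable \<tau>"
  unfolding weight_def by measurable

lemma weight_pos [simp]: "weight \<theta> x > 0"
  by (simp add: weight_def)

text \<open>The density is strictly positive, so both measures have the same null sets.\<close>

lemma AE_gibbs_iff:
  assumes "norm_const \<theta> > 0"
  shows "(AE x in gibbs \<theta>. P x) \<longleftrightarrow> (AE x in \<tau>. P x)"
  unfolding gibbs_def using assms by (subst AE_density) (auto simp: divide_simps)

text \<open>The log-density is the affine function
  \<open>- (\<theta> \<bullet> X x) - ln (norm_const \<theta>)\<close> of \<open>X x\<close>, so the
  mean determines its integral; being integrable, it makes the extended-real divergence agree with
  the real one.\<close>

lemma KL_ereal_gibbs:
  assumes pos: "norm_const \<theta> > 0" and mean: "has_mean (gibbs \<theta>) u"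
  shows "KL_ereal \<tau> (gibbs \<theta>) = ereal (- (ln (norm_const \<theta>) + \<theta> \<bullet> u))"
proof -
  interpret p: prob_space "gibbs \<theta>" using mean by (simp add: has_mean_def)
  note has_mean_def[THEN iffD1, OF mean]
  then have int: "integrable (gibbs \<theta>) (\<lambda>x. \<theta> \<bullet> X x)"
    and eq: "(LINT x|gibbs \<theta>. \<theta> \<bullet> X x) = \<theta> \<bullet> u" by auto
  let ?g = "\<lambda>x. - (\<theta> \<bullet> X x) - ln (norm_const \<theta>)"
  have [measurable_cong]: "sets (gibbs \<theta>) = sets \<tau>" by (simp add: gibbs_def)
  have "AE x in \<tau>. ennreal (weight \<theta> x / norm_const \<theta>) = RN_deriv \<tau> (gibbs \<theta>) x"
    by (rule RN_deriv_unique) (auto simp: gibbs_def)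
  then have "AE x in gibbs \<theta>. ennreal (weight \<theta> x / norm_const \<theta>) = RN_deriv \<tau> (gibbs \<theta>) x"
    by (simp add: AE_gibbs_iff[OF pos])
  then have AE: "AE x in gibbs \<theta>. ?g x = entropy_density (exp 1) \<tau> (gibbs \<theta>) x"
  proof eventually_elim
    case (elim x)
    have "RN_deriv \<tau> (gibbs \<theta>) x = ennreal (weight \<theta> x / norm_const \<theta>)" using elim by simp
    then show ?case using pos
      by (simp add: entropy_density_def log_def ln_div weight_def)
  qed
  have int_g: "integrable (gibbs \<theta>) ?g" using int by simp
  have int_e: "integrable (gibbs \<theta>) (entropy_density (exp 1) \<tau> (gibbs \<theta>))"
    using int_g by (rule integrable_cong_AE_imp) (use AE in \<open>auto simp: eq_commute\<close>)
  have "KL_divergence (exp 1) \<tau> (gibbs \<theta>) = (LINT x|gibbs \<theta>. ?g x)"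
    unfolding KL_divergence_def using AE by (intro integral_cong_AE) auto
  also have "\<dots> = - (\<theta> \<bullet> u) - ln (norm_const \<theta>)"
    using int eq p.prob_space by simp
  finally show ?thesis
    using KL_ereal_eq_KL_divergence[OF int_e] by simp
qed

text \<open>
  With \<open>d = \<eta> - \<theta>\<close>, integrating \<open>exp (- d \<bullet> (X - u)) \<ge> 1 - d \<bullet> (X - u)\<close> against
  the Gibbs measure at \<open>\<theta>\<close> gives the inequality, and strictness of \<open>exp t > 1 + t\<close> for
  \<open>t \<noteq> 0\<close> gives the equality case.
\<close>

lemma
  assumes int: "integrable \<tau> (weight \<eta>)"
    and pos: "norm_const \<theta> > 0" "norm_const \<eta> > 0"
    and mean: "has_mean (gibbs \<theta>) u"
  shows free_entropy_min: "ln (norm_const \<theta>) + \<theta> \<bullet> u \<le> ln (norm_const \<eta>) + \<eta> \<bullet> u" (is ?le)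
    and free_entropy_min_eqD: "ln (norm_const \<eta>) + \<eta> \<bullet> u = ln (norm_const \<theta>) + \<theta> \<bullet> u \<Longrightarrow>
      AE x in \<tau>. (\<eta> - \<theta>) \<bullet> X x = (\<eta> - \<theta>) \<bullet> u" (is "?eq \<Longrightarrow> ?AE")
proof -
  interpret p: prob_space "gibbs \<theta>" using mean by (simp add: has_mean_def)
  define d where "d = \<eta> - \<theta>"
  have int_d: "integrable (gibbs \<theta>) (\<lambda>x. d \<bullet> X x)"
    and mean_d: "(LINT x|gibbs \<theta>. d \<bullet> X x) = d \<bullet> u"
    using mean by (auto simp: has_mean_def)
  define t where "t x = - (d \<bullet> X x) + d \<bullet> u" for x
  have [measurable]: "t \<in> borel_measurable \<tau>" unfolding t_def by measurable
  have [measurable_cong]: "sets (gibbs \<theta>) = sets \<tau>" by (simp add: gibbs_def)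
  \<comment> \<open>Multiplying the Gibbs density at \<open>\<theta>\<close> by
    \<open>exp (t x)\<close> yields a constant multiple of the weight at \<open>\<eta>\<close>;
    integrals of \<open>exp (t x)\<close> thus reduce to \<open>norm_const \<eta>\<close>.\<close>
  have tilt: "weight \<theta> x * exp (t x) / norm_const \<theta> = exp (d \<bullet> u) / norm_const \<theta> * weight \<eta> x" for x
    by (simp add: weight_def t_def d_def inner_diff_left exp_add[symmetric] exp_diff[symmetric] field_simps)
  have int_exp: "integrable (gibbs \<theta>) (\<lambda>x. exp (t x))"
    unfolding gibbs_def using pos int
    by (subst integrable_density) (auto simp: tilt less_imp_le)
  have "(LINT x|gibbs \<theta>. exp (t x)) = (LINT x|\<tau>. exp (d \<bullet> u) / norm_const \<theta> * weight \<eta> x)"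
    unfolding gibbs_def using pos
    by (subst integral_density) (auto simp: tilt less_imp_le)
  also have "\<dots> = exp (d \<bullet> u) * norm_const \<eta> / norm_const \<theta>"
    by (simp add: norm_const_def)
  also have "\<dots> = exp (ln (norm_const \<eta>) + \<eta> \<bullet> u - (ln (norm_const \<theta>) + \<theta> \<bullet> u))"
    using pos by (simp add: exp_add exp_diff d_def inner_diff_left mult.commute)
  finally have val: "(LINT x|gibbs \<theta>. exp (t x)) =
      exp (ln (norm_const \<eta>) + \<eta> \<bullet> u - (ln (norm_const \<theta>) + \<theta> \<bullet> u))" .
  have int_t: "integrable (gibbs \<theta>) t" and mean_t: "(LINT x|gibbs \<theta>. t x) = 0"
    using int_d mean_d by (simp_all add: t_def[abs_def] p.prob_space)
  \<comment> \<open>Since \<open>t\<close> has mean 0, the integral of this nonnegative defect is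
    the exponential of the free entropy difference, minus 1.\<close>
  define gap where "gap x = exp (t x) - 1 - t x" for x
  have gap_nonneg: "gap x \<ge> 0" for x
    using exp_ge_add_one_self[of "t x"] unfolding gap_def by linarith
  have int_gap: "integrable (gibbs \<theta>) gap"
    using int_exp int_t by (simp add: gap_def[abs_def])
  have val_gap: "(LINT x|gibbs \<theta>. gap x) =
      exp (ln (norm_const \<eta>) + \<eta> \<bullet> u - (ln (norm_const \<theta>) + \<theta> \<bullet> u)) - 1"
    using int_exp int_t by (simp add: gap_def[abs_def] val mean_t p.prob_space)
  have "(LINT x|gibbs \<theta>. gap x) \<ge> 0" using gap_nonneg by simp
  then show ?le unfolding val_gap by simp
  assume ?eq
  then have "(LINT x|gibbs \<theta>. gap x) = 0" unfolding val_gap by simp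
  then have "AE x in gibbs \<theta>. gap x = 0"
    using int_gap gap_nonneg by (simp add: integral_nonneg_eq_0_iff_AE)
  then have "AE x in \<tau>. gap x = 0" by (simp add: AE_gibbs_iff[OF pos(1)])
  then show ?AE
  proof eventually_elim
    case (elim x)
    then have "t x = 0"
      using ln_eq_minus_one[of "exp (t x)"] by (simp add: gap_def)
    then show ?case by (simp add: t_def d_def)
  qed
qed

text \<open>The exponential of the free entropy at \<open>\<xi>\<close> is the integral of
  \<open>exp (- (\<xi> \<bullet> (X x - w)))\<close>, which is convex in \<open>\<xi>\<close> for
  each \<open>x\<close>; its value between two points is at most the larger end value. Only the ends
  and the one intermediate point enter, so the rest of the segment may leave the parameter
  domain.\<close>

lemma free_entropy_quasiconvex:
  fixes t :: real
  defines "\<zeta> \<theta> \<eta> \<equiv> (1 - t) *\<^sub>R \<theta> + t *\<^sub>R \<eta>"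
  assumes int: "integrable \<tau> (weight \<theta>)" "integrable \<tau> (weight \<eta>)" "integrable \<tau> (weight (\<zeta> \<theta> \<eta>))"
    and pos: "norm_const \<theta> > 0" "norm_const \<eta> > 0" "norm_const (\<zeta> \<theta> \<eta>) > 0"
    and t: "0 \<le> t" "t \<le> 1"
    and le: "ln (norm_const \<eta>) + \<eta> \<bullet> w \<le> ln (norm_const \<theta>) + \<theta> \<bullet> w"
  shows "ln (norm_const (\<zeta> \<theta> \<eta>)) + \<zeta> \<theta> \<eta> \<bullet> w \<le> ln (norm_const \<theta>) + \<theta> \<bullet> w"
proof -
  define f where "f \<xi> x = exp (\<xi> \<bullet> w) * weight \<xi> x" for \<xi> x
  have f_eq: "f \<xi> x = exp (- (\<xi> \<bullet> (X x - w)))" for \<xi> x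
    by (simp add: f_def weight_def mult_exp_exp inner_diff_right)
  have exp_eq: "exp (ln (norm_const \<xi>) + \<xi> \<bullet> w) = (LINT x|\<tau>. f \<xi> x)" if "norm_const \<xi> > 0" for \<xi>
    using that by (simp add: f_def exp_add norm_const_def mult.commute)
  have int_f: "integrable \<tau> (f \<theta>)" "integrable \<tau> (f \<eta>)" "integrable \<tau> (f (\<zeta> \<theta> \<eta>))"
    using int by (simp_all add: f_def[abs_def])
  have "f (\<zeta> \<theta> \<eta>) x \<le> (1 - t) * f \<theta> x + t * f \<eta> x" for x
    using convex_onD[OF exp_convex t, of "- (\<theta> \<bullet> (X x - w))" "- (\<eta> \<bullet> (X x - w))"]
    by (simp add: f_eq \<zeta>_def inner_add_left)
  then have "(LINT x|\<tau>. f (\<zeta> \<theta> \<eta>) x) \<le> (LINT x|\<tau>. (1 - t) * f \<theta> x + t * f \<eta> x)"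
    using int_f by (intro integral_mono) auto
  also have "\<dots> = (1 - t) * (LINT x|\<tau>. f \<theta> x) + t * (LINT x|\<tau>. f \<eta> x)"
    using int_f by simp
  also have "\<dots> \<le> (1 - t) * (LINT x|\<tau>. f \<theta> x) + t * (LINT x|\<tau>. f \<theta> x)"
    using t le by (intro add_left_mono mult_left_mono) (simp_all flip: exp_eq add: pos)
  finally have "(LINT x|\<tau>. f (\<zeta> \<theta> \<eta>) x) \<le> (LINT x|\<tau>. f \<theta> x)"
    by (simp add: algebra_simps)
  then show ?thesis by (simp flip: exp_eq add: pos)
qed

lemma has_derivative_free_entropy:
  assumes D: "open D" "u \<in> D" and G: "open G" "\<And>w. w \<in> D \<Longrightarrow> \<theta> w \<in> G"
    and int: "\<And>\<eta>. \<eta> \<in> G \<Longrightarrow> integrable \<tau> (weight \<eta>)"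
    and pos: "\<And>\<eta>. \<eta> \<in> G \<Longrightarrow> norm_const \<eta> > 0"
    and cont: "continuous_on G (\<lambda>\<eta>. ln (norm_const \<eta>))"
    and mean: "\<And>w. w \<in> D \<Longrightarrow> has_mean (gibbs (\<theta> w)) w"
  shows "((\<lambda>w. ln (norm_const (\<theta> w)) + \<theta> w \<bullet> w) has_derivative (\<lambda>h. \<theta> u \<bullet> h)) (at u)"
proof (rule has_derivative_of_unique_minimizer[OF D G cont])
  show min: "ln (norm_const (\<theta> w)) + \<theta> w \<bullet> w \<le> ln (norm_const \<eta>) + \<eta> \<bullet> w" if "w \<in> D" "\<eta> \<in> G" for w \<eta>
    using that by (intro free_entropy_min int pos mean G)
  show "ln (norm_const ((1 - t) *\<^sub>R \<theta> u + t *\<^sub>R \<theta> w)) + ((1 - t) *\<^sub>R \<theta> u + t *\<^sub>R \<theta> w) \<bullet> w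
      \<le> ln (norm_const (\<theta> u)) + \<theta> u \<bullet> w"
    if "w \<in> D" "0 \<le> t" "t \<le> 1" "(1 - t) *\<^sub>R \<theta> u + t *\<^sub>R \<theta> w \<in> G" for w t
    using that D by (intro free_entropy_quasiconvex min int pos G)
  \<comment> \<open>Otherwise \<open>X\<close> would lie a.e. in a hyperplane through \<open>u\<close>, and so would every mean in \<open>D\<close>.\<close>
  show "\<eta> = \<theta> u"
    if \<eta>: "\<eta> \<in> G" and eq: "ln (norm_const \<eta>) + \<eta> \<bullet> u = ln (norm_const (\<theta> u)) + \<theta> u \<bullet> u" for \<eta>
  proof -
    define d where "d = \<eta> - \<theta> u"
    have AE: "AE x in \<tau>. d \<bullet> X x = d \<bullet> u"
      unfolding d_def using D \<eta> by (intro free_entropy_min_eqD[OF _ _ _ _ eq] int pos mean G)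
    have flat: "d \<bullet> w = d \<bullet> u" if "w \<in> D" for w
    proof -
      interpret p: prob_space "gibbs (\<theta> w)" using mean[OF that] by (simp add: has_mean_def)
      have [measurable_cong]: "sets (gibbs (\<theta> w)) = sets \<tau>" by (simp add: gibbs_def)
      have "d \<bullet> w = (LINT x|gibbs (\<theta> w). d \<bullet> X x)"
        using mean[OF that] by (simp add: has_mean_def)
      also have "\<dots> = (LINT x|gibbs (\<theta> w). d \<bullet> u)"
        using AE pos[OF G(2)[OF that]] by (intro integral_cong_AE) (auto simp: AE_gibbs_iff)
      finally show ?thesis by (simp add: p.prob_space)
    qed
    obtain e where e: "e > 0" "ball u e \<subseteq> D" using D open_contains_ball by blast
    \<comment> \<open>The summand 1 keeps the denominator positive and gives
      \<open>s * norm d < e\<close>. Moving the mean from \<open>u\<close> along \<open>d\<close> by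
      \<open>s\<close> stays in \<open>D\<close>, so \<open>flat\<close> forces
      \<open>d \<bullet> d = 0\<close>.\<close>
    define s where "s = e / (norm d + 1)"
    have s: "s > 0" using e by (simp add: s_def add_nonneg_pos)
    have "s * (norm d + 1) = e"
      using norm_ge_zero[of d] by (simp add: s_def del: norm_ge_zero)
    with s have "s * norm d < e" by (simp add: distrib_left)
    then have "u + s *\<^sub>R d \<in> D" using e s by (auto simp: dist_norm)
    from flat[OF this] s have "d = 0" by (simp add: inner_add_right)
    then show ?thesis by (simp add: d_def)
  qed
qed

end

section \<open>The three constraints and the thermodynamic differentials\<close>

theorem proposition1:
  fixes \<tau> :: "'a measure" and Y :: "'b measure" and M :: "'a \<Rightarrow> 'b"
    and E N :: "'a \<Rightarrow> real"
    and D G :: "(real \<times> real \<times> real) set"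
    and pstar :: "real \<times> real \<times> real \<Rightarrow> 'a measure"
    and \<beta> \<alpha> \<pi> :: "real \<times> real \<times> real \<Rightarrow> real"
  assumes "sigma_finite_measure \<tau>"
    and "M \<in> measurable \<tau> Y"
    and "E \<in> borel_measurable \<tau>" and "N \<in> borel_measurable \<tau>"
    and "\<And>x. x \<in> space \<tau> \<Longrightarrow> cell \<tau> M (M x) \<in> sets \<tau>"
    and "\<And>x. x \<in> space \<tau> \<Longrightarrow> 0 < info_volume \<tau> M (M x) \<and> info_volume \<tau> M (M x) < \<infinity>"
    and "log_volume \<tau> M \<in> borel_measurable \<tau>"
    and "open D"
    and "\<And>u q. u \<in> D \<Longrightarrow>
           is_arg_min (KL_ereal \<tau>) (feasible \<tau> E N (log_volume \<tau> M) u) q \<longleftrightarrow> q = pstar u"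
    and "open G"
    and "\<And>u. u \<in> D \<Longrightarrow> (\<beta> u, \<alpha> u, \<pi> u) \<in> G"
    and "\<And>u. u \<in> D \<Longrightarrow> pstar u = gibbs_measure \<tau> E N (log_volume \<tau> M) (\<beta> u, \<alpha> u, \<pi> u)"
    and "\<And>\<theta>. \<theta> \<in> G \<Longrightarrow>
           0 < partition_function \<tau> E N (log_volume \<tau> M) \<theta> \<and>
           partition_function \<tau> E N (log_volume \<tau> M) \<theta> < \<infinity>"
    and "C2_on G (log_partition \<tau> E N (log_volume \<tau> M))"
    and "convex_within G (log_partition \<tau> E N (log_volume \<tau> M))"
  shows "\<forall>u\<in>D.
      \<bar>KL_ereal \<tau> (pstar u)\<bar> \<noteq> \<infinity> \<and>
      (max_entropy \<tau> pstar has_derivative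
         (\<lambda>(dU, dN, dL). \<beta> u * dU + \<alpha> u * dN + \<pi> u * dL)) (at u) \<and>
      (\<forall>T \<mu> P. \<beta> u \<noteq> 0 \<and> 1 / T = \<beta> u \<and> - \<mu> / T = \<alpha> u \<and> P / T = \<pi> u \<longrightarrow>
         frechet_derivative (\<lambda>(U, Nbar, Lbar). U) (at u) =
           (\<lambda>h. T * frechet_derivative (max_entropy \<tau> pstar) (at u) h
              - P * frechet_derivative (\<lambda>(U, Nbar, Lbar). Lbar) (at u) h
              + \<mu> * frechet_derivative (\<lambda>(U, Nbar, Lbar). Nbar) (at u) h))"
proof
  fix u assume u: "u \<in> D"
  note sf = assms(1) and [measurable] = assms(3,4,7) and D = assms(8) and argmin = assms(9)
    and G = assms(10,11) and pstar = assms(12) and Z = assms(13) and C2 = assms(14)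
  define L where "L = log_volume \<tau> M"
  \<comment> \<open>The inner product of the nested product type turns the three-term exponent into
    \<open>- (\<theta> \<bullet> X x)\<close>.\<close>
  define X where "X x = (E x, N x, L x)" for x
  have [measurable]: "L \<in> borel_measurable \<tau>" by (simp add: L_def)
  have X_measurable: "X \<in> borel_measurable \<tau>"
    unfolding X_def by measurable
  interpret exponential_family \<tau> X
    using sf X_measurable by (simp add: exponential_family_def exponential_family_axioms_def)
  define \<theta> where "\<theta> w = (\<beta> w, \<alpha> w, \<pi> w)" for w
  have gw: "gibbs_weight E N L \<eta> = weight \<eta>" for \<eta>
    by (auto simp: gibbs_weight_def weight_def X_def inner_prod_def algebra_simps split: prod.splits)
  \<comment> \<open>Valid for every \<open>\<eta>\<close>: where the partition function is infinite,
    both sides take the default value 0.\<close>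
  have pf: "enn2real (partition_function \<tau> E N L \<eta>) = norm_const \<eta>" for \<eta>
    unfolding partition_function_def norm_const_def gw
    by (subst integral_eq_nn_integral) (auto simp: less_imp_le)
  have lp: "log_partition \<tau> E N L = (\<lambda>\<eta>. ln (norm_const \<eta>))"
    by (simp add: fun_eq_iff log_partition_def pf)
  have gm: "gibbs_measure \<tau> E N L \<eta> = gibbs \<eta>" for \<eta>
    by (simp add: gibbs_measure_def gibbs_def gw pf)
  have pos: "norm_const \<eta> > 0" and int: "integrable \<tau> (weight \<eta>)" if "\<eta> \<in> G" for \<eta>
  proof -
    show "norm_const \<eta> > 0"
      using Z[OF that] unfolding pf[symmetric] L_def by (simp add: enn2real_positive_iff)
    show "integrable \<tau> (weight \<eta>)"
      using Z[OF that] unfolding partition_function_def L_def[symmetric] gw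
      by (intro integrableI_nonneg) (auto simp: less_imp_le)
  qed
  have cont: "continuous_on G (\<lambda>\<eta>. ln (norm_const \<eta>))"
  proof -
    obtain f' where "\<And>x. x \<in> G \<Longrightarrow> ((\<lambda>\<eta>. ln (norm_const \<eta>)) has_derivative blinfun_apply (f' x)) (at x)"
      using C2 unfolding C2_on_def L_def[symmetric] lp by blast
    then show ?thesis
      by (intro continuous_at_imp_continuous_on ballI has_derivative_continuous)
  qed
  have \<theta>_in: "\<theta> w \<in> G" and p_eq: "pstar w = gibbs (\<theta> w)" if "w \<in> D" for w
    using G(2)[OF that] pstar[OF that] by (simp_all add: \<theta>_def gm flip: L_def)
  have mean: "has_mean (gibbs (\<theta> w)) w" if w: "w \<in> D" for w
  proof -
    \<comment> \<open>A minimizer is feasible, which gives the means of the three coordinates of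
      \<open>X\<close> and hence of all their linear combinations.\<close>
    have "feasible \<tau> E N L w (gibbs (\<theta> w))"
      using argmin[OF w, of "pstar w"] p_eq[OF w] by (simp add: is_arg_min_def L_def)
    then show ?thesis
      by (cases w) (simp add: feasible_def has_mean_def X_def inner_prod_def split_beta)
  qed
  have KL: "KL_ereal \<tau> (pstar w) = ereal (- (ln (norm_const (\<theta> w)) + \<theta> w \<bullet> w))" if "w \<in> D" for w
    using KL_ereal_gibbs[OF pos mean] that by (simp add: \<theta>_in p_eq)
  have lin: "(\<lambda>h. \<theta> u \<bullet> h) = (\<lambda>(dU, dN, dL). \<beta> u * dU + \<alpha> u * dN + \<pi> u * dL)"
    by (auto simp: \<theta>_def inner_prod_def algebra_simps)
  have "((\<lambda>w. ln (norm_const (\<theta> w)) + \<theta> w \<bullet> w) has_derivative (\<lambda>h. \<theta> u \<bullet> h)) (at u)"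
    by (rule has_derivative_free_entropy[OF D u G(1) \<theta>_in int pos cont mean])
  then have deriv: "(max_entropy \<tau> pstar has_derivative
      (\<lambda>(dU, dN, dL). \<beta> u * dU + \<alpha> u * dN + \<pi> u * dL)) (at u)"
    unfolding lin
    \<comment> \<open>The entropy equals the free entropy on \<open>D\<close>, and \<open>D\<close>
      is open, so the derivative at \<open>u\<close> carries over.\<close>
    by (rule has_derivative_transform_within_open[OF _ D u]) (simp add: max_entropy_def KL)
  have bl: "bounded_linear (\<lambda>(a, b, c). a :: real)" "bounded_linear (\<lambda>(a, b, c). b :: real)"
      "bounded_linear (\<lambda>(a, b, c). c :: real)"
    unfolding split_beta
    by (intro bounded_linear_fst bounded_linear_snd bounded_linear_compose[OF bounded_linear_fst]
        bounded_linear_compose[OF bounded_linear_snd])+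
  note fd = frechet_derivative_at[symmetric]
  have "frechet_derivative (\<lambda>(U, Nbar, Lbar). U) (at u) =
           (\<lambda>h. T * frechet_derivative (max_entropy \<tau> pstar) (at u) h
              - P * frechet_derivative (\<lambda>(U, Nbar, Lbar). Lbar) (at u) h
              + \<mu> * frechet_derivative (\<lambda>(U, Nbar, Lbar). Nbar) (at u) h)"
    if T: "\<beta> u \<noteq> 0" "1 / T = \<beta> u" "- \<mu> / T = \<alpha> u" "P / T = \<pi> u" for T \<mu> P
  proof -
    \<comment> \<open>For \<open>T = 0\<close> the convention \<open>1 / 0 = 0\<close> would
      contradict \<open>\<beta> u \<noteq> 0\<close>.\<close>
    have "T \<noteq> 0" using T by auto
    then have "T * \<beta> u = 1" "T * \<alpha> u = - \<mu>" "T * \<pi> u = P"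
      by (simp_all flip: T(2-4))
    moreover have "T * (\<beta> u * a + \<alpha> u * b + \<pi> u * c) = (T * \<beta> u) * a + (T * \<alpha> u) * b + (T * \<pi> u) * c"
      for a b c by (simp add: algebra_simps)
    \<comment> \<open>The coordinate maps are linear and so are their own derivatives; what remains
      is \<open>T\<close> times the entropy differential, solved for the first coordinate.\<close>
    ultimately show ?thesis
      unfolding fd[OF deriv] fd[OF bounded_linear_imp_has_derivative[OF bl(1)]]
        fd[OF bounded_linear_imp_has_derivative[OF bl(2)]]
        fd[OF bounded_linear_imp_has_derivative[OF bl(3)]]
      by (auto simp: fun_eq_iff)
  qed
  with deriv show "\<bar>KL_ereal \<tau> (pstar u)\<bar> \<noteq> \<infinity> \<and>
      (max_entropy \<tau> pstar has_derivative
         (\<lambda>(dU, dN, dL). \<beta> u * dU + \<alpha> u * dN + \<pi> u * dL)) (at u) \<and>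
      (\<forall>T \<mu> P. \<beta> u \<noteq> 0 \<and> 1 / T = \<beta> u \<and> - \<mu> / T = \<alpha> u \<and> P / T = \<pi> u \<longrightarrow>
         frechet_derivative (\<lambda>(U, Nbar, Lbar). U) (at u) =
           (\<lambda>h. T * frechet_derivative (max_entropy \<tau> pstar) (at u) h
              - P * frechet_derivative (\<lambda>(U, Nbar, Lbar). Lbar) (at u) h
              + \<mu> * frechet_derivative (\<lambda>(U, Nbar, Lbar). Nbar) (at u) h))"
    by (simp add: KL[OF u])
qed

end
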